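(* Let $\mathcal{K}$ be the set of all triples $(K_1,K_2,K_3)$ of complex $2\times 2$ matrices with $\sum_{i=1}^3 K_i^\dagger K_i=I$. There is a subset $\mathcal{N}\subset\mathcal{K}$ of measure zero such that for every $(K_1,K_2,K_3)\in\mathcal{K}\setminus\mathcal{N}$, with associated qubit channel $\Lambda_1(\rho)=\sum_{i=1}^3 K_i\rho K_i^\dagger$ (of Kraus rank at most $3$), and for every qubit channel $\Lambda_2$, the following holds: if the channel $\mathbb{1}\otimes(\Lambda_2\circ\Lambda_1)$ preserves entanglement for some two-qubit input state (i.e. it is not entanglement-annihilating), then the product channel $\Lambda_1\otimes\Lambda_2$ also preserves entanglement for some two-qubit input state (i.e. it is not entanglement-annihilating).
   Context: A qubit channel is a completely positive trace-preserving linear map on complex $2\times2$ matrices; its Kraus rank is the minimal number of Kraus operators representing it. $\mathbb{1}$ in a tensor product of maps denotes the identity map. A bipartite channel $\Phi_1\otimes\Phi_2$ is entanglement-annihilating (EA) if for every bipartite input state $|\psi\rangle\in\mathbb{C}^2\otimes\mathbb{C}^2$ the output $(\Phi_1\otimes\Phi_2)(|\psi\rangle\langle\psi|)$ is separable (a convex combination of product density matrices); it "preserves entanglement for some input state" if it is not EA. The set $\mathcal{K}$ is regarded as a smooth compact submanifold of $(\mathbb{C}^{2\times2})^3\cong\mathbb{R}^{24}$ (the complex Stiefel manifold of isometries $\mathbb{C}^2\to\mathbb{C}^6$), and "measure zero" is with respect to its natural Riemannian volume measure. *)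

theory Defs
  imports "HOL-Analysis.Analysis"
begin

section \<open>Qubit channels and entanglement annihilation\<close>

type_synonym qubit_op = "complex^2^2"
type_synonym two_qubit_op = "complex^(2 \<times> 2)^(2 \<times> 2)"

definition dagger :: "complex^'n^'m \<Rightarrow> complex^'m^'n" where
  "dagger A = (\<chi> i j. cnj (A $ j $ i))"

definition cscale :: "complex \<Rightarrow> complex^'n^'m \<Rightarrow> complex^'n^'m" where
  "cscale c A = (\<chi> i j. c * A $ i $ j)"

text \<open>Over the complex numbers the condition below forces \<open>A\<close> to be Hermitian.\<close>

definition psd :: "complex^'n^'n \<Rightarrow> bool" where
  "psd A \<longleftrightarrow> (\<forall>v. (\<Sum>i\<in>UNIV. \<Sum>j\<in>UNIV. cnj (v $ i) * A $ i $ j * v $ j) \<in> nonneg_Reals)"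

definition density_matrix :: "complex^'n^'n \<Rightarrow> bool" where
  "density_matrix \<rho> \<longleftrightarrow> psd \<rho> \<and> trace \<rho> = 1"

text \<open>An operator on \<open>\<complex>\<^sup>n \<otimes> \<complex>\<^sup>2\<close> is an \<open>n \<times> n\<close> array of \<open>2 \<times> 2\<close> blocks, of which only
  the entries with indices below \<open>n\<close> matter. Applying \<open>\<Phi>\<close> to every block is the action of
  \<open>id \<otimes> \<Phi>\<close>.\<close>

definition block_psd :: "nat \<Rightarrow> (nat \<Rightarrow> nat \<Rightarrow> qubit_op) \<Rightarrow> bool" where
  "block_psd n X \<longleftrightarrow> (\<forall>v :: nat \<Rightarrow> complex^2.
     (\<Sum>a<n. \<Sum>b<n. \<Sum>i\<in>UNIV. \<Sum>j\<in>UNIV. cnj (v a $ i) * X a b $ i $ j * v b $ j)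
       \<in> nonneg_Reals)"

definition completely_positive :: "(qubit_op \<Rightarrow> qubit_op) \<Rightarrow> bool" where
  "completely_positive \<Phi> \<longleftrightarrow>
     (\<forall>n X. block_psd n X \<longrightarrow> block_psd n (\<lambda>a b. \<Phi> (X a b)))"

definition qubit_channel :: "(qubit_op \<Rightarrow> qubit_op) \<Rightarrow> bool" where
  "qubit_channel \<Phi> \<longleftrightarrow>
     (\<forall>A B. \<Phi> (A + B) = \<Phi> A + \<Phi> B) \<and>
     (\<forall>c A. \<Phi> (cscale c A) = cscale c (\<Phi> A)) \<and>
     completely_positive \<Phi> \<and>
     (\<forall>A. trace (\<Phi> A) = trace A)"

definition kron :: "qubit_op \<Rightarrow> qubit_op \<Rightarrow> two_qubit_op" where
  "kron A B = (\<chi> p q. A $ fst p $ fst q * B $ snd p $ snd q)"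

definition matrix_unit :: "2 \<Rightarrow> 2 \<Rightarrow> qubit_op" where
  "matrix_unit i j = (\<chi> a b. if a = i \<and> b = j then 1 else 0)"

text \<open>For linear \<open>\<Phi>\<close> and \<open>\<Psi>\<close> this is the linear map determined by
  \<open>A \<otimes> B \<mapsto> \<Phi> A \<otimes> \<Psi> B\<close>, written out by expanding \<open>X\<close> in products of matrix units.\<close>

definition tensor_map ::
    "(qubit_op \<Rightarrow> qubit_op) \<Rightarrow> (qubit_op \<Rightarrow> qubit_op) \<Rightarrow> two_qubit_op \<Rightarrow> two_qubit_op" where
  "tensor_map \<Phi> \<Psi> X =
     (\<Sum>i\<in>UNIV. \<Sum>j\<in>UNIV. \<Sum>k\<in>UNIV. \<Sum>l\<in>UNIV.
        cscale (X $ (i, k) $ (j, l)) (kron (\<Phi> (matrix_unit i j)) (\<Psi> (matrix_unit k l))))"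

definition separable :: "two_qubit_op \<Rightarrow> bool" where
  "separable \<rho> \<longleftrightarrow>
     \<rho> \<in> convex hull {kron \<sigma> \<tau> | \<sigma> \<tau>. density_matrix \<sigma> \<and> density_matrix \<tau>}"

definition ketbra :: "complex^'n \<Rightarrow> complex^'n^'n" where
  "ketbra \<psi> = (\<chi> p q. \<psi> $ p * cnj (\<psi> $ q))"

definition entanglement_annihilating :: "(two_qubit_op \<Rightarrow> two_qubit_op) \<Rightarrow> bool" where
  "entanglement_annihilating \<Phi> \<longleftrightarrow>
     (\<forall>\<psi> :: complex^(2 \<times> 2). norm \<psi> = 1 \<longrightarrow> separable (\<Phi> (ketbra \<psi>)))"

definition kraus_triples :: "(qubit_op^3) set" where
  "kraus_triples = {K. (\<Sum>i\<in>UNIV. dagger (K $ i) ** (K $ i)) = mat 1}"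

definition kraus_channel :: "qubit_op^3 \<Rightarrow> qubit_op \<Rightarrow> qubit_op" where
  "kraus_channel K \<rho> = (\<Sum>i\<in>UNIV. K $ i ** \<rho> ** dagger (K $ i))"

section \<open>Null sets of the Riemannian volume of an embedded submanifold\<close>

text \<open>Regular local parametrizations of \<open>M\<close>. Continuously differentiable ones are allowed rather
  than only smooth ones: the volume formula is the same for them, and on a smooth submanifold both
  classes yield the same null sets.\<close>

definition local_parametrization ::
    "'a::euclidean_space set \<Rightarrow> (real^'n) set \<Rightarrow> (real^'n \<Rightarrow> 'a) \<Rightarrow> bool" where
  "local_parametrization M U \<phi> \<longleftrightarrow>
     open U \<and> openin (top_of_set M) (\<phi> ` U) \<and>
     (\<exists>\<kappa>. homeomorphism U (\<phi> ` U) \<phi> \<kappa>) \<and>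
     (\<forall>u\<in>U. \<phi> differentiable (at u)) \<and>
     (\<forall>v. continuous_on U (\<lambda>u. frechet_derivative \<phi> (at u) v)) \<and>
     (\<forall>u\<in>U. inj (frechet_derivative \<phi> (at u)))"

text \<open>The metric that the ambient inner product induces on the parameter domain, and the
  Riemannian volume in these coordinates, with density \<open>\<surd>(det g)\<close>.\<close>

definition induced_metric :: "(real^'n \<Rightarrow> 'a::euclidean_space) \<Rightarrow> real^'n \<Rightarrow> real^'n^'n" where
  "induced_metric \<phi> u =
     (\<chi> i j. frechet_derivative \<phi> (at u) (axis i 1) \<bullet> frechet_derivative \<phi> (at u) (axis j 1))"

definition coordinate_volume ::
    "(real^'n) set \<Rightarrow> (real^'n \<Rightarrow> 'a::euclidean_space) \<Rightarrow> (real^'n) measure" where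
  "coordinate_volume U \<phi> =
     density (lebesgue_on U) (\<lambda>u. ennreal (sqrt (det (induced_metric \<phi> u))))"

text \<open>The dimension \<open>CARD('n)\<close> of the submanifold \<open>M\<close> has to be supplied: for a wrong dimension
  there are no nonempty parametrizations and every subset of \<open>M\<close> would count as null. By second
  countability, vanishing in every parametrization is the same as vanishing of the volume.\<close>

definition riemannian_null ::
    "'n::finite itself \<Rightarrow> 'a::euclidean_space set \<Rightarrow> 'a set \<Rightarrow> bool" where
  "riemannian_null d M N \<longleftrightarrow> N \<subseteq> M \<and>
     (\<forall>U (\<phi> :: real^'n \<Rightarrow> 'a). local_parametrization M U \<phi> \<longrightarrow>
        {u \<in> U. \<phi> u \<in> N} \<in> null_sets (coordinate_volume U \<phi>))"

text \<open>\<open>kraus_triples\<close> is cut out of a real vector space of dimension 24 by the equation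
  \<open>\<Sum>K\<^sub>i\<^sup>\<dagger> K\<^sub>i = I\<close> between Hermitian \<open>2 \<times> 2\<close> matrices, that is, by four independent real equations,
  so it has dimension 20. The inner product of \<open>qubit_op^3\<close> is that of \<open>\<real>\<^sup>2\<^sup>4\<close>.\<close>

definition kraus_null :: "(qubit_op^3) set \<Rightarrow> bool" where
  "kraus_null N \<longleftrightarrow> riemannian_null TYPE(20) kraus_triples N"

end

theory Submission
  imports Defs "HOL-Computational_Algebra.Polynomial"
begin

text \<open>
  For three Kraus operators, asking that all \<open>A K\<^sub>i\<close> be symmetric gives three linear equations in
  the four entries of \<open>A\<close>, so there is a nonzero solution; generically it is invertible. Then
  \<open>K\<^sub>i\<^sup>T = A K\<^sub>i A\<^sup>-\<^sup>T\<close>. Identify \<open>\<psi>\<close> with a matrix \<open>\<Psi>\<close>, so that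
  \<open>1 \<otimes> K\<^sub>i\<close> acts as \<open>\<Psi> K\<^sub>i\<^sup>T = (\<Psi> A) K\<^sub>i A\<^sup>-\<^sup>T\<close>: the output of \<open>1 \<otimes> \<Lambda>\<^sub>2 \<Lambda>\<^sub>1\<close> on
  \<open>\<psi>\<close> is, up to a scalar, the output of \<open>\<Lambda>\<^sub>1 \<otimes> \<Lambda>\<^sub>2\<close> on the vector with matrix
  \<open>A\<^sup>-\<^sup>T\<close>, conjugated by the local filter \<open>\<Psi> A \<otimes> 1\<close>. Local filters preserve separability.

  The exceptional triples lie in the zero set of a nonzero homogeneous polynomial on
  \<open>\<real>\<^sup>2\<^sup>4\<close>. The exceptional set is moreover invariant under \<open>K\<^sub>i \<mapsto> K\<^sub>i T\<close> for invertible \<open>T\<close>, so in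
  Gram-Schmidt coordinates \<open>X = K T\<close> with \<open>K\<close> isometric and \<open>T\<close> triangular it is a product
  with an open set, and Fubini makes it null in every chart of \<open>kraus_triples\<close>.
\<close>

section \<open>Local filters and separability\<close>

text \<open>Conjugation of \<open>X\<close> by \<open>B\<close> tensored with the identity. No
  normalization is built in: this keeps it linear in \<open>X\<close>, but the trace may
  change.\<close>

definition local_filter :: "qubit_op \<Rightarrow> two_qubit_op \<Rightarrow> two_qubit_op" where
  "local_filter B X = (\<chi> p q. \<Sum>i\<in>UNIV. \<Sum>j\<in>UNIV.
     B $ fst p $ i * X $ (i, snd p) $ (j, snd q) * cnj (B $ fst q $ j))"

lemma local_filter_add: "local_filter B (X + Y) = local_filter B X + local_filter B Y"
  by (simp add: local_filter_def vec_eq_iff algebra_simps sum.distrib)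

lemma local_filter_scaleR: "local_filter B (c *\<^sub>R X) = c *\<^sub>R local_filter B X"
  by (simp add: local_filter_def vec_eq_iff scaleR_sum_right)

lemma kron_scaleR_left: "kron (c *\<^sub>R A) B = c *\<^sub>R kron A B"
  by (simp add: kron_def vec_eq_iff)

lemma local_filter_kron: "local_filter B (kron \<sigma> \<tau>) = kron (B ** \<sigma> ** dagger B) \<tau>"
  by (simp add: local_filter_def kron_def dagger_def matrix_matrix_mult_def vec_eq_iff sum_2
      algebra_simps)

lemma trace_add_scaleR: "trace (u *\<^sub>R X + v *\<^sub>R Y :: complex^'n^'n) = u *\<^sub>R trace X + v *\<^sub>R trace Y"
  by (simp add: trace_def sum.distrib scaleR_sum_right)

lemma sum_UNIV_prod:
  fixes g :: "'a::finite \<times> 'b::finite \<Rightarrow> 'c::comm_monoid_add"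
  shows "(\<Sum>p\<in>UNIV. g p) = (\<Sum>i\<in>UNIV. \<Sum>k\<in>UNIV. g (i, k))"
  by (metis UNIV_Times_UNIV sum.cartesian_product')

lemma trace_kron: "trace (kron A B) = trace A * trace B"
  by (simp add: trace_def kron_def sum_UNIV_prod sum_product)

text \<open>Product states have trace one, and trace one is an affine condition, so it passes to the
  convex hull.\<close>

lemma trace_separable:
  assumes "separable \<rho>"
  shows "trace \<rho> = 1"
proof -
  let ?S = "{kron \<sigma> \<tau> | \<sigma> \<tau>. density_matrix \<sigma> \<and> density_matrix \<tau>}"
  have "convex {X :: two_qubit_op. trace X = 1}"
    by (auto simp: convex_def trace_add_scaleR simp flip: scaleR_add_left)
  then have "convex hull ?S \<subseteq> {X. trace X = 1}"
    by (rule hull_minimal[rotated]) (auto simp: trace_kron density_matrix_def)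
  then have "\<rho> \<in> {X. trace X = 1}"
    by (rule subsetD) (rule assms[unfolded separable_def])
  then show ?thesis
    by simp
qed

lemma separable_convex:
  assumes "separable X" "separable Y" "0 \<le> u" "0 \<le> v" "u + v = 1"
  shows "separable (u *\<^sub>R X + v *\<^sub>R Y)"
  using convexD[OF convex_convex_hull assms[unfolded separable_def]] by (simp only: separable_def)

section \<open>Positive semidefinite matrices and the cone of separable states\<close>

lemma psd_conjugate:
  assumes "psd (A :: qubit_op)"
  shows "psd (B ** A ** dagger (B :: qubit_op))"
  unfolding psd_def
proof
  fix v :: "complex^2"
  have eq: "(\<Sum>i\<in>UNIV. \<Sum>j\<in>UNIV. cnj (v $ i) * (B ** A ** dagger B) $ i $ j * v $ j) =
     (\<Sum>i\<in>UNIV. \<Sum>j\<in>UNIV. cnj ((dagger B *v v) $ i) * A $ i $ j * (dagger B *v v) $ j)"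
    by (simp only: matrix_matrix_mult_def matrix_vector_mult_def dagger_def sum_2 vec_lambda_beta
        complex_cnj_add complex_cnj_mult complex_cnj_cnj ring_distribs ac_simps)
  show "(\<Sum>i\<in>UNIV. \<Sum>j\<in>UNIV. cnj (v $ i) * (B ** A ** dagger B) $ i $ j * v $ j)
      \<in> nonneg_Reals"
    unfolding eq by (rule assms[unfolded psd_def, THEN spec])
qed

lemma psd_quadratic_form_2:
  assumes "psd (A :: qubit_op)"
  shows "cnj x * A$1$1 * x + cnj x * A$1$2 * y + cnj y * A$2$1 * x + cnj y * A$2$2 * y
    \<in> nonneg_Reals"
  using assms[unfolded psd_def, THEN spec, of "vector [x, y]"]
  by (simp add: sum_2 algebra_simps)

text \<open>The diagonal entries are nonnegative with sum zero, so they vanish. The form at (1, z)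
  then changes sign with z, hence is zero; z = 1 and z = i determine both off-diagonal
  entries.\<close>

lemma psd_trace_0:
  assumes "psd (A :: qubit_op)" "trace A = 0"
  shows "A = 0"
proof -
  note q = psd_quadratic_form_2[OF assms(1)]
  have 1: "A$1$1 = 0" and 2: "A$2$2 = 0"
    using q[of 1 0] q[of 0 1] assms(2)
    by (auto simp: trace_def sum_2 complex_nonneg_Reals_iff complex_eq_iff)
  have 3: "A$1$2 * z + A$2$1 * cnj z \<in> nonneg_Reals" for z
    using q[of 1 z] 1 2 by (simp add: algebra_simps)
  have opp: "z = 0" if "z \<in> nonneg_Reals" "- z \<in> nonneg_Reals" for z :: complex
    using that by (simp add: complex_nonneg_Reals_iff complex_eq_iff)
  have "A$1$2 + A$2$1 = 0"
    using 3[of 1] 3[of "-1"] by (intro opp) simp_all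
  moreover have "A$1$2 * \<i> + A$2$1 * cnj \<i> = 0"
    using 3[of \<i>] 3[of "-\<i>"] by (intro opp) simp_all
  then have "A$1$2 - A$2$1 = 0"
    by (simp add: algebra_simps)
  ultimately have "A$1$2 = 0" "A$2$1 = 0"
    by algebra+
  with 1 2 show ?thesis
    unfolding vec_eq_iff forall_2 by simp
qed

lemma psd_trace_real:
  assumes "psd (A :: qubit_op)"
  obtains t where "0 \<le> t" "trace A = of_real t"
proof -
  have "trace A \<in> nonneg_Reals"
    using psd_quadratic_form_2[OF assms, of 1 0] psd_quadratic_form_2[OF assms, of 0 1]
    by (auto simp: trace_def sum_2 intro: nonneg_Reals_add_I)
  then show thesis
    using that by (auto simp: nonneg_Reals_def)
qed

lemma psd_eq_scaled_density:
  assumes "psd (A :: qubit_op)"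
  obtains t \<sigma> where "0 \<le> t" "density_matrix \<sigma>" "A = t *\<^sub>R \<sigma>"
proof -
  obtain t where t: "0 \<le> t" "trace A = of_real t"
    using psd_trace_real[OF assms] .
  show thesis
  proof (cases "t = 0")
    case True
    \<comment> \<open>Here \<open>A\<close> is zero and gets weight 0, so any density matrix will
      do.\<close>
    define \<sigma> :: qubit_op where "\<sigma> = matrix_unit 1 1"
    have "density_matrix \<sigma>"
      by (simp add: \<sigma>_def density_matrix_def psd_def matrix_unit_def trace_def sum_2
          complex_nonneg_Reals_iff)
    moreover have "A = 0 *\<^sub>R \<sigma>"
      using psd_trace_0[OF assms] t True by simp
    ultimately show thesis
      using that by blast
  next
    case False
    let ?\<sigma> = "(1/t) *\<^sub>R A"
    have "psd ?\<sigma>"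
      unfolding psd_def
    proof
      fix v :: "complex^2"
      have eq: "(\<Sum>i\<in>UNIV. \<Sum>j\<in>UNIV. cnj (v $ i) * ?\<sigma> $ i $ j * v $ j) =
          of_real (1/t) * (\<Sum>i\<in>UNIV. \<Sum>j\<in>UNIV. cnj (v $ i) * A $ i $ j * v $ j)"
        by (simp add: sum_distrib_left scaleR_conv_of_real[where 'a = complex] mult_ac)
      show "(\<Sum>i\<in>UNIV. \<Sum>j\<in>UNIV. cnj (v $ i) * ?\<sigma> $ i $ j * v $ j) \<in> nonneg_Reals"
        unfolding eq using t(1) assms[unfolded psd_def] by (intro nonneg_Reals_mult_I) auto
    qed
    moreover have "trace ?\<sigma> = 1"
      using t False trace_add_scaleR[of "1/t" A 0 0] by (simp add: scaleR_conv_of_real)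
    ultimately show thesis
      using that[of t ?\<sigma>] t False by (simp add: density_matrix_def)
  qed
qed

text \<open>A filter rescales product states and may even kill them, so the image lies in the cone
  over the separable states, with t = 0 allowed. The preimage \<open>?C\<close> of that cone is
  convex, hence only the product generators have to be checked.\<close>

lemma separable_local_filter_cone:
  assumes "separable \<rho>"
  shows "\<exists>t\<ge>0. \<exists>\<rho>'. separable \<rho>' \<and> local_filter B \<rho> = t *\<^sub>R \<rho>'"
proof -
  let ?C = "{X. \<exists>t\<ge>0. \<exists>\<rho>'. separable \<rho>' \<and> local_filter B X = t *\<^sub>R \<rho>'}"
  let ?S = "{kron \<sigma> \<tau> | \<sigma> \<tau>. density_matrix \<sigma> \<and> density_matrix \<tau>}"
  have "?S \<subseteq> ?C"
  proof clarify
    fix \<sigma> \<tau> :: qubit_op assume d: "density_matrix \<sigma>" "density_matrix \<tau>"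
    obtain t \<sigma>' where t: "0 \<le> t" "density_matrix \<sigma>'" "B ** \<sigma> ** dagger B = t *\<^sub>R \<sigma>'"
      using d psd_conjugate psd_eq_scaled_density unfolding density_matrix_def by metis
    moreover have "separable (kron \<sigma>' \<tau>)"
      unfolding separable_def using t d by (intro hull_inc) auto
    ultimately show "\<exists>t\<ge>0. \<exists>\<rho>'. separable \<rho>' \<and> local_filter B (kron \<sigma> \<tau>) = t *\<^sub>R \<rho>'"
      by (metis local_filter_kron kron_scaleR_left)
  qed
  moreover have "convex ?C"
  proof (rule convexI, clarify)
    fix X Y X' Y' :: two_qubit_op and u v s t :: real
    assume uv: "0 \<le> u" "0 \<le> v" "u + v = 1"
      and s: "0 \<le> s" "separable X'" "local_filter B X = s *\<^sub>R X'"
      and t: "0 \<le> t" "separable Y'" "local_filter B Y = t *\<^sub>R Y'"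
    define w where "w = u * s + v * t"
    have w0: "0 \<le> u * s" "0 \<le> v * t"
      using uv s t by auto
    have eq: "local_filter B (u *\<^sub>R X + v *\<^sub>R Y) = (u * s) *\<^sub>R X' + (v * t) *\<^sub>R Y'"
      by (simp add: local_filter_add local_filter_scaleR s t)
    show "\<exists>r\<ge>0. \<exists>\<rho>'. separable \<rho>' \<and> local_filter B (u *\<^sub>R X + v *\<^sub>R Y) = r *\<^sub>R \<rho>'"
    proof (cases "w = 0")
      \<comment> \<open>The mixture cannot be renormalized, but both of its weights vanish, so
        weight 0 on the state \<open>X'\<close> suffices.\<close>
      case True
      then have "u * s = 0" "v * t = 0"
        using w0 unfolding w_def by linarith+
      then have "local_filter B (u *\<^sub>R X + v *\<^sub>R Y) = 0 *\<^sub>R X'"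
        unfolding eq by (simp only: \<open>u * s = 0\<close> \<open>v * t = 0\<close>) simp
      then show ?thesis using s by blast
    next
      case False
      let ?Z = "(u * s / w) *\<^sub>R X' + (v * t / w) *\<^sub>R Y'"
      have "w \<ge> 0" using w0 unfolding w_def by simp
      moreover have "separable ?Z"
        using s t w0 \<open>w \<ge> 0\<close> False
        by (intro separable_convex) (auto simp: w_def simp flip: add_divide_distrib)
      moreover have "local_filter B (u *\<^sub>R X + v *\<^sub>R Y) = w *\<^sub>R ?Z"
        unfolding eq using False by (simp add: scaleR_add_right)
      ultimately show ?thesis by blast
    qed
  qed
  ultimately have "convex hull ?S \<subseteq> ?C"
    by (rule hull_minimal)
  then have "\<rho> \<in> ?C"
    by (rule subsetD) (rule assms[unfolded separable_def])
  then show ?thesis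
    by simp
qed

lemma separable_local_filter:
  assumes "separable \<rho>" "trace (local_filter B \<rho>) = 1"
  shows "separable (local_filter B \<rho>)"
proof -
  obtain t \<rho>' where t: "separable \<rho>'" "local_filter B \<rho> = t *\<^sub>R \<rho>'"
    using separable_local_filter_cone[OF assms(1)] by blast
  then have "of_real t = (1::complex)"
    using assms(2) trace_separable[OF t(1)] trace_add_scaleR[of t \<rho>' 0 0]
    by (simp add: scaleR_conv_of_real)
  then show ?thesis
    using t by simp
qed

section \<open>Matrix entries and traces of channel outputs\<close>

lemma channel_sum:
  assumes "qubit_channel \<Phi>" "finite S"
  shows "\<Phi> (\<Sum>x\<in>S. f x) = (\<Sum>x\<in>S. \<Phi> (f x))"
proof -
  have "\<Phi> (0 + 0) = \<Phi> 0 + \<Phi> 0"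
    using assms(1) unfolding qubit_channel_def by blast
  then have "\<Phi> 0 = 0" by simp
  with assms(2) show ?thesis
    using assms(1) by (induction S rule: finite_induct) (auto simp: qubit_channel_def)
qed

lemma channel_expand:
  assumes "qubit_channel \<Phi>"
  shows "\<Phi> X $ c $ d = (\<Sum>m\<in>UNIV. \<Sum>n\<in>UNIV. X $ m $ n * \<Phi> (matrix_unit m n) $ c $ d)"
proof -
  have hom: "\<Phi> (cscale c A) = cscale c (\<Phi> A)" for c A
    using assms by (simp add: qubit_channel_def)
  have "X = (\<Sum>m\<in>UNIV. \<Sum>n\<in>UNIV. cscale (X $ m $ n) (matrix_unit m n))"
    unfolding vec_eq_iff forall_2 sum_2 by (simp add: cscale_def matrix_unit_def)
  then have "\<Phi> X = \<Phi> (\<Sum>m\<in>UNIV. \<Sum>n\<in>UNIV. cscale (X $ m $ n) (matrix_unit m n))"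
    by (rule arg_cong)
  also have "\<dots> = (\<Sum>m\<in>UNIV. \<Sum>n\<in>UNIV. cscale (X $ m $ n) (\<Phi> (matrix_unit m n)))"
    by (simp only: channel_sum[OF assms finite] hom)
  finally show ?thesis
    by (simp add: cscale_def)
qed

lemma kraus_channel_nth:
  "kraus_channel K X $ a $ b =
     (\<Sum>r\<in>UNIV. \<Sum>i\<in>UNIV. \<Sum>j\<in>UNIV. K$r$a$i * X$i$j * cnj (K$r$b$j))"
  by (simp add: kraus_channel_def matrix_matrix_mult_def dagger_def sum_2 algebra_simps)

lemma tensor_map_nth:
  "tensor_map \<Phi> \<Psi> X $ (a,c) $ (b,d) =
     (\<Sum>i\<in>UNIV. \<Sum>j\<in>UNIV. \<Sum>k\<in>UNIV. \<Sum>l\<in>UNIV.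
        X $ (i,k) $ (j,l) * (\<Phi> (matrix_unit i j) $ a $ b * \<Psi> (matrix_unit k l) $ c $ d))"
  by (simp add: tensor_map_def cscale_def kron_def)

lemma trace_prod: "trace (X :: two_qubit_op) = (\<Sum>a\<in>UNIV. \<Sum>c\<in>UNIV. X $ (a,c) $ (a,c))"
  by (simp add: trace_def sum_UNIV_prod)

lemma trace_kraus_channel:
  assumes "K \<in> kraus_triples"
  shows "trace (kraus_channel K X) = trace X"
proof -
  have 1: "(\<Sum>r\<in>UNIV. dagger (K $ r) ** (K $ r)) $ i $ j = mat 1 $ i $ j" for i j
    using assms by (simp add: kraus_triples_def)
  have "trace (kraus_channel K X) = (\<Sum>i\<in>UNIV. \<Sum>j\<in>UNIV.
      (\<Sum>r\<in>UNIV. dagger (K $ r) ** (K $ r)) $ j $ i * X $ i $ j)"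
    by (simp add: trace_def kraus_channel_nth dagger_def matrix_matrix_mult_def sum_2 sum_3
        algebra_simps)
  then show ?thesis
    unfolding 1 by (simp add: mat_def trace_def sum_2)
qed

lemma sum_norm_sq_prod:
  fixes \<psi> :: "complex^(2 \<times> 2)"
  shows "(\<Sum>i\<in>UNIV. \<Sum>k\<in>UNIV. \<psi> $ (i,k) * cnj (\<psi> $ (i,k))) = of_real ((norm \<psi>)\<^sup>2)"
proof -
  have "(\<Sum>i\<in>UNIV. \<Sum>k\<in>UNIV. \<psi> $ (i,k) * cnj (\<psi> $ (i,k))) =
      (\<Sum>p\<in>UNIV. \<psi> $ p * cnj (\<psi> $ p))"
    by (simp add: sum_UNIV_prod)
  also have "\<dots> = of_real ((norm \<psi>)\<^sup>2)"
    by (simp add: norm_vec_def L2_set_def sum_nonneg complex_norm_square del: of_real_power)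
  finally show ?thesis .
qed

lemma trace_tensor_map_id:
  assumes "\<And>X. trace (\<Phi> X) = trace X" "norm \<psi> = 1"
  shows "trace (tensor_map id \<Phi> (ketbra \<psi>)) = 1"
proof -
  have "trace (tensor_map id \<Phi> (ketbra \<psi>)) =
     (\<Sum>i\<in>UNIV. \<Sum>j\<in>UNIV. \<Sum>k\<in>UNIV. \<Sum>l\<in>UNIV. \<psi>$(i,k) * cnj (\<psi>$(j,l)) *
        (trace (matrix_unit i j) * trace (\<Phi> (matrix_unit k l))))"
    by (simp add: trace_prod tensor_map_nth ketbra_def trace_def sum_2 algebra_simps)
  also have "\<dots> = (\<Sum>i\<in>UNIV. \<Sum>k\<in>UNIV. \<psi> $ (i,k) * cnj (\<psi> $ (i,k)))"
    unfolding assms(1) by (simp add: trace_def matrix_unit_def sum_2)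
  finally show ?thesis
    using assms(2) by (simp add: sum_norm_sq_prod)
qed

text \<open>Under this identification \<open>B \<otimes> C\<close> acts as \<open>\<Psi> \<mapsto> B \<Psi> C\<^sup>T\<close>.\<close>

definition reshape :: "complex^(2 \<times> 2) \<Rightarrow> qubit_op" where
  "reshape \<psi> = (\<chi> i k. \<psi> $ (i, k))"

text \<open>This and \<open>local_filter_tensor_nth\<close> bring the two outputs to a common form,
  a sum over r depending only on matrices \<open>M r\<close> and on the values of \<Phi> at matrix
  units. Here \<open>M r\<close> is \<open>reshape \<psi> ** transpose (K$r)\<close>, there it is
  \<open>B ** K$r ** reshape \<phi>\<close>; equating these matrices equates the outputs.\<close>

lemma tensor_id_comp_nth:
  assumes "qubit_channel \<Phi>"
  shows "tensor_map id (\<Phi> \<circ> kraus_channel K) (ketbra \<psi>) $ (a,c) $ (b,d) =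
    (\<Sum>m\<in>UNIV. \<Sum>n\<in>UNIV.
      (\<Sum>r\<in>UNIV. (reshape \<psi> ** transpose (K$r)) $ a $ m *
                  cnj ((reshape \<psi> ** transpose (K$r)) $ b $ n)) *
      \<Phi> (matrix_unit m n) $ c $ d)"
proof -
  have "tensor_map id (\<Phi> \<circ> kraus_channel K) (ketbra \<psi>) $ (a,c) $ (b,d) =
     (\<Sum>k\<in>UNIV. \<Sum>l\<in>UNIV. \<psi>$(a,k) * cnj (\<psi>$(b,l)) *
        \<Phi> (kraus_channel K (matrix_unit k l)) $ c $ d)"
    using exhaust_2[of a] exhaust_2[of b]
    by (auto simp: tensor_map_nth ketbra_def matrix_unit_def sum_2)
  also have "\<dots> = (\<Sum>k\<in>UNIV. \<Sum>l\<in>UNIV. \<psi>$(a,k) * cnj (\<psi>$(b,l)) *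
        (\<Sum>m\<in>UNIV. \<Sum>n\<in>UNIV. kraus_channel K (matrix_unit k l) $ m $ n *
          \<Phi> (matrix_unit m n) $ c $ d))"
    by (subst channel_expand[OF assms]) (rule refl)
  also have "\<dots> = (\<Sum>m\<in>UNIV. \<Sum>n\<in>UNIV. (\<Sum>k\<in>UNIV. \<Sum>l\<in>UNIV. \<psi>$(a,k) * cnj (\<psi>$(b,l)) *
        kraus_channel K (matrix_unit k l) $ m $ n) * \<Phi> (matrix_unit m n) $ c $ d)"
    by (simp add: sum_2 algebra_simps)
  moreover have "(\<Sum>k\<in>UNIV. \<Sum>l\<in>UNIV. \<psi>$(a,k) * cnj (\<psi>$(b,l)) *
        kraus_channel K (matrix_unit k l) $ m $ n) =
      (\<Sum>r\<in>UNIV. (reshape \<psi> ** transpose (K$r)) $ a $ m *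
                  cnj ((reshape \<psi> ** transpose (K$r)) $ b $ n))" for m n
    by (simp add: kraus_channel_nth matrix_unit_def reshape_def transpose_def
        matrix_matrix_mult_def sum_2 sum_3 algebra_simps)
  ultimately show ?thesis by simp
qed

lemma local_filter_tensor_nth:
  "local_filter B (tensor_map (kraus_channel K) \<Phi> (ketbra \<phi>)) $ (a,c) $ (b,d) =
    (\<Sum>m\<in>UNIV. \<Sum>n\<in>UNIV.
      (\<Sum>r\<in>UNIV. (B ** K$r ** reshape \<phi>) $ a $ m * cnj ((B ** K$r ** reshape \<phi>) $ b $ n)) *
      \<Phi> (matrix_unit m n) $ c $ d)"
proof -
  define P where "P m n = \<Phi> (matrix_unit m n) $ c $ d" for m n
  have "tensor_map (kraus_channel K) \<Phi> (ketbra \<phi>) $ (e,c) $ (f,d) =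
     (\<Sum>m\<in>UNIV. \<Sum>n\<in>UNIV. (\<Sum>r\<in>UNIV. (K$r ** reshape \<phi>) $ e $ m *
        cnj ((K$r ** reshape \<phi>) $ f $ n)) * P m n)" for e f
    by (simp add: tensor_map_nth ketbra_def kraus_channel_nth matrix_unit_def reshape_def P_def
        matrix_matrix_mult_def sum_2 sum_3 algebra_simps)
  then have "local_filter B (tensor_map (kraus_channel K) \<Phi> (ketbra \<phi>)) $ (a,c) $ (b,d) =
     (\<Sum>e\<in>UNIV. \<Sum>f\<in>UNIV. B$a$e * (\<Sum>m\<in>UNIV. \<Sum>n\<in>UNIV. (\<Sum>r\<in>UNIV. (K$r ** reshape \<phi>) $ e $ m *
        cnj ((K$r ** reshape \<phi>) $ f $ n)) * P m n) * cnj (B$b$f))"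
    by (simp add: local_filter_def)
  also have "\<dots> = (\<Sum>m\<in>UNIV. \<Sum>n\<in>UNIV. (\<Sum>r\<in>UNIV.
      (\<Sum>e\<in>UNIV. B$a$e * (K$r ** reshape \<phi>) $ e $ m) *
      cnj (\<Sum>f\<in>UNIV. B$b$f * (K$r ** reshape \<phi>) $ f $ n)) * P m n)"
    by (simp add: sum_2 sum_3 algebra_simps)
  moreover have "(\<Sum>e\<in>UNIV. B$a$e * (K$r ** reshape \<phi>) $ e $ m) =
     (B ** K$r ** reshape \<phi>) $ a $ m" for r a m
    unfolding matrix_mul_assoc[symmetric] by (simp add: matrix_matrix_mult_def[of B])
  ultimately show ?thesis
    by (simp add: P_def)
qed

section \<open>Comparing the two channels for symmetrizable triples\<close>

lemma matrix_mult_scaleR_left: "(c *\<^sub>R (A :: qubit_op)) ** B = c *\<^sub>R (A ** B)"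
  by (simp add: matrix_matrix_mult_def vec_eq_iff scaleR_sum_right)

lemma matrix_mult_scaleR_right: "(A :: qubit_op) ** (c *\<^sub>R B) = c *\<^sub>R (A ** B)"
  by (simp add: matrix_matrix_mult_def vec_eq_iff scaleR_sum_right)

text \<open>One matrix \<open>A\<close> must serve all three operators. The plain transpose, without
  conjugation, makes the condition complex linear in \<open>A\<close>.\<close>

definition symmetrizable :: "qubit_op^3 \<Rightarrow> bool" where
  "symmetrizable K \<longleftrightarrow> (\<exists>A. invertible A \<and> (\<forall>r. transpose (A ** K$r) = A ** K$r))"

lemma symmetrizable_not_EA:
  assumes K: "K \<in> kraus_triples" "symmetrizable K" and ch: "qubit_channel \<Phi>"
    and EA: "entanglement_annihilating (tensor_map (kraus_channel K) \<Phi>)"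
  shows "entanglement_annihilating (tensor_map id (\<Phi> \<circ> kraus_channel K))"
  unfolding entanglement_annihilating_def
proof (intro allI impI)
  fix \<psi> :: "complex^(2 \<times> 2)" assume \<psi>: "norm \<psi> = 1"
  obtain A where A: "invertible A" "\<And>r. transpose (A ** K$r) = A ** K$r"
    using K(2) unfolding symmetrizable_def by blast
  obtain A' where A': "A ** A' = mat 1" "A' ** A = mat 1"
    using A(1) unfolding invertible_def by blast
  define C where "C = transpose A'"
  have C: "transpose A ** C = mat 1"
    unfolding C_def matrix_transpose_mul[symmetric] A' by (rule transpose_mat)
  have KT: "transpose (K$r) = A ** K$r ** C" for r
  proof -
    have "A ** K$r ** C = transpose (A ** K$r) ** C"
      by (simp only: A(2))
    also have "\<dots> = transpose (K$r) ** (transpose A ** C)"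
      by (simp only: matrix_transpose_mul matrix_mul_assoc)
    finally show ?thesis by (simp add: C)
  qed
  define \<omega> :: "complex^(2 \<times> 2)" where "\<omega> = (\<chi> p. C $ fst p $ snd p)"
  have "\<omega> \<noteq> 0"
  proof
    assume "\<omega> = 0"
    then have "C = 0"
      by (simp add: \<omega>_def vec_eq_iff)
    then show False
      using C by (simp add: vec_eq_iff matrix_matrix_mult_def mat_def) (metis zero_neq_one)
  qed
  define s where "s = norm \<omega>"
  have s: "s > 0" using \<open>\<omega> \<noteq> 0\<close> by (simp add: s_def)
  \<comment> \<open>Annihilation is assumed for unit vectors only, so the vector of \<open>C\<close>
    is divided by its norm \<open>s\<close>, and the filter \<open>B\<close> carries the
    compensating factor.\<close>
  define \<phi> where "\<phi> = (1/s) *\<^sub>R \<omega>"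
  define B where "B = s *\<^sub>R (reshape \<psi> ** A)"
  have eq: "B ** K$r ** reshape \<phi> = reshape \<psi> ** transpose (K$r)" for r
  proof -
    have "reshape \<phi> = (1/s) *\<^sub>R C"
      by (simp add: reshape_def \<phi>_def \<omega>_def vec_eq_iff)
    then have "B ** K$r ** reshape \<phi> = reshape \<psi> ** A ** K$r ** C"
      using s unfolding B_def
      by (simp add: matrix_mult_scaleR_left matrix_mult_scaleR_right)
    then show ?thesis
      by (simp add: KT matrix_mul_assoc)
  qed
  have filter: "local_filter B (tensor_map (kraus_channel K) \<Phi> (ketbra \<phi>)) =
      tensor_map id (\<Phi> \<circ> kraus_channel K) (ketbra \<psi>)"
    unfolding vec_eq_iff split_paired_All local_filter_tensor_nth tensor_id_comp_nth[OF ch] eq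
    by (intro allI refl)
  have "norm \<phi> = 1"
    using s by (simp add: \<phi>_def s_def)
  then have "separable (tensor_map (kraus_channel K) \<Phi> (ketbra \<phi>))"
    using EA unfolding entanglement_annihilating_def by blast
  \<comment> \<open>Trace preservation fixes the trace of the filtered state, so the filtered output
    is itself separable rather than just a multiple of a separable state.\<close>
  moreover have "trace (tensor_map id (\<Phi> \<circ> kraus_channel K) (ketbra \<psi>)) = 1"
    using ch \<psi> by (intro trace_tensor_map_id)
      (auto simp: trace_kraus_channel[OF K(1)] qubit_channel_def)
  ultimately show "separable (tensor_map id (\<Phi> \<circ> kraus_channel K) (ketbra \<psi>))"
    using separable_local_filter filter by metis
qed

section \<open>Null sets\<close>

text \<open>The translates of a bounded part of \<open>Z\<close> by multiples of \<open>d\<close> overlap at most \<open>m\<close> times and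
  stay in a bounded set, so infinitely many of them fit only if their common measure is zero.\<close>

lemma negligible_finite_slices:
  fixes Z :: "'a::euclidean_space set"
  assumes Z: "Z \<in> sets lebesgue"
    and fin: "\<And>x. finite {t::real. x + t *\<^sub>R d \<in> Z}"
    and card: "\<And>x. card {t::real. x + t *\<^sub>R d \<in> Z} \<le> m"
  shows "negligible Z"
proof -
  have "negligible (Z \<inter> cbox a b)" for a b
  proof -
    define S where "S = Z \<inter> cbox a b"
    have S: "S \<in> lmeasurable"
      unfolding S_def by (intro bounded_set_imp_lmeasurable sets.Int Z bounded_Int) auto
    obtain r where r: "S \<subseteq> ball 0 r"
      by (metis S_def bounded_Int bounded_cbox bounded_subset_ballD)
    define W where "W = cball (0::'a) (r + norm d)"
    have W: "W \<in> lmeasurable" by (simp add: W_def)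
    let ?T = "\<lambda>t. (+) (t *\<^sub>R d) ` S"
    have T: "?T t \<in> lmeasurable" for t
      using S by (rule measurable_translation)
    have bound: "n * measure lebesgue S \<le> m * measure lebesgue W" for n :: nat
    proof -
      \<comment> \<open>These are n distinct shifts in [0,1]; the unit bound keeps every translate
        of \<open>S\<close> inside \<open>W\<close>, however large n is.\<close>
      define I where "I = (\<lambda>k::nat. 1 / (real k + 1)) ` {..<n}"
      have I: "finite I" "card I = n" "I \<subseteq> {0..1}"
        by (auto simp: I_def card_image inj_on_def divide_simps)
      have "(\<Sum>t\<in>I. indicator (?T t) x) \<le> m * (indicator W x :: real)" for x
      proof (cases "x \<in> W")
        case True
        have "(\<Sum>t\<in>I. indicator (?T t) x :: real) = card {t \<in> I. x \<in> ?T t}"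
          using I(1) by (simp add: indicator_def sum.If_cases Int_def)
        \<comment> \<open>A translate by t covers x only if the line through x meets
          \<open>Z\<close> at parameter -t, hence the reflection.\<close>
        also have "{t \<in> I. x \<in> ?T t} \<subseteq> uminus ` {t. x + t *\<^sub>R d \<in> Z}"
        proof
          fix t assume "t \<in> {t \<in> I. x \<in> ?T t}"
          then obtain s where "s \<in> S" "x = t *\<^sub>R d + s" by auto
          then have "x + (- t) *\<^sub>R d \<in> Z" by (simp add: S_def)
          then show "t \<in> uminus ` {t. x + t *\<^sub>R d \<in> Z}"
            by (intro image_eqI[of _ _ "- t"]) auto
        qed
        then have "card {t \<in> I. x \<in> ?T t} \<le> card (uminus ` {t. x + t *\<^sub>R d \<in> Z})"
          using fin by (intro card_mono) auto
        also have "\<dots> \<le> m"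
          using card_image_le[OF fin] card le_trans by blast
        finally show ?thesis using True by simp
      next
        case False
        have "x \<notin> ?T t" if "t \<in> I" for t
        proof
          assume "x \<in> ?T t"
          then obtain s where s: "s \<in> S" "x = t *\<^sub>R d + s" by auto
          have "\<bar>t\<bar> \<le> 1" using I(3) that by auto
          then have "norm (t *\<^sub>R d) \<le> norm d" by (simp add: mult_left_le_one_le)
          moreover have "norm s < r" using s r by auto
          ultimately have "norm x \<le> r + norm d"
            unfolding s(2) using norm_triangle_ineq[of "t *\<^sub>R d" s] by linarith
          then show False using False by (simp add: W_def)
        qed
        then show ?thesis using False by simp
      qed
      then have "(\<integral>x. (\<Sum>t\<in>I. indicator (?T t) x) \<partial>lebesgue) \<le>
          (\<integral>x. m * (indicator W x :: real) \<partial>lebesgue)"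
        using T W by (intro integral_mono Bochner_Integration.integrable_sum integrable_mult_right)
          (simp_all only: lmeasurable_iff_integrable)
      also have "(\<integral>x. (\<Sum>t\<in>I. indicator (?T t) x) \<partial>lebesgue) =
          (\<Sum>t\<in>I. measure lebesgue (?T t))"
        using T by (subst Bochner_Integration.integral_sum)
          (simp_all only: lmeasurable_iff_integrable, simp)
      finally show ?thesis
        using I(2) by (simp add: measure_translation)
    qed
    have "measure lebesgue S = 0"
    proof (rule ccontr)
      assume "measure lebesgue S \<noteq> 0"
      then have "measure lebesgue S > 0" by (simp add: less_le)
      then obtain n :: nat where "m * measure lebesgue W < n * measure lebesgue S"
        using reals_Archimedean3 by blast
      then show False using bound[of n] by simp
    qed
    then show ?thesis
      using S by (simp add: S_def negligible_iff_measure)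
  qed
  then show ?thesis
    using negligible_on_intervals by blast
qed

text \<open>Fubini: almost every vertical section of the product is null, but the section over a
  point of \<open>S\<close> is all of \<open>B\<close>. Working with almost-everywhere statements
  avoids measurability questions about \<open>S\<close> and \<open>B\<close>.\<close>

lemma negligible_Times_left:
  fixes S :: "'a::euclidean_space set" and B :: "'b::euclidean_space set"
  assumes "negligible (S \<times> B)" "\<not> negligible B"
  shows "negligible S"
proof -
  have neg: "negligible N \<longleftrightarrow> (AE x in lborel. x \<notin> N)" for N :: "'c::euclidean_space set"
    using completion.null_sets_iff_AE[of N lborel]
    by (simp add: negligible_iff_null_sets AE_completion_iff)
  have "AE z in lborel \<Otimes>\<^sub>M lborel. z \<notin> S \<times> B"
    using assms(1) unfolding neg lborel_prod .
  then have "AE x in lborel. AE y in lborel. (x, y) \<notin> S \<times> B"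
    by (rule lborel_pair.AE_pair)
  then have "AE x in lborel. x \<notin> S"
  proof (rule AE_mp, intro AE_I2 impI notI)
    fix x assume "AE y in lborel. (x, y) \<notin> S \<times> B" "x \<in> S"
    then have "AE y in lborel. y \<notin> B" by simp
    then show False using assms(2) by (simp add: neg)
  qed
  then show ?thesis by (simp add: neg)
qed

text \<open>Reduces nullity for the Riemannian volume in a chart to Lebesgue nullity.\<close>

lemma null_sets_density:
  assumes "A \<in> null_sets M"
  shows "A \<in> null_sets (density M f)"
proof -
  have "(\<integral>\<^sup>+ x. f x * indicator A x \<partial>M) = (\<integral>\<^sup>+ x. 0 \<partial>M)"
    using AE_not_in[OF assms] by (intro nn_integral_cong_AE) (auto simp: indicator_def)
  then show ?thesis
    using assms by (auto simp: null_sets_def density_def emeasure_measure_of_conv)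
qed

section \<open>Transport of null sets through charts\<close>

lemma differentiable_imp_pointwise_Lipschitz:
  fixes f :: "'a::real_normed_vector \<Rightarrow> 'b::real_normed_vector"
  assumes "f differentiable at x"
  obtains d B where "0 < d" "\<And>y. norm (y - x) < d \<Longrightarrow> norm (f y - f x) \<le> B * norm (y - x)"
proof -
  obtain f' where f': "(f has_derivative f') (at x)"
    using assms by (auto simp: differentiable_def)
  obtain C where C: "\<And>h. norm (f' h) \<le> C * norm h"
    using bounded_linear.bounded[OF has_derivative_bounded_linear[OF f']] by (metis mult.commute)
  obtain d where d: "0 < d"
      "\<And>y. norm (y - x) < d \<Longrightarrow> norm (f y - f x - f' (y - x)) \<le> 1 * norm (y - x)"
    using f' unfolding has_derivative_at_alt by (meson zero_less_one)
  have "norm (f y - f x) \<le> (C + 1) * norm (y - x)" if "norm (y - x) < d" for y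
  proof -
    have "norm (f y - f x) \<le> norm (f' (y - x)) + norm (f y - f x - f' (y - x))"
      by (metis add.commute diff_add_cancel norm_triangle_ineq)
    then show ?thesis
      using C[of "y - x"] d(2)[OF that] by (simp add: algebra_simps)
  qed
  then show thesis using that d(1) by blast
qed

text \<open>An injective linear map in finite dimension is bounded below by some C > 0, and near x
  the remainder uses up at most half of it. This yields a pointwise Lipschitz bound for the inverse
  of a chart.\<close>

lemma immersion_pointwise_expanding:
  fixes f :: "'a::euclidean_space \<Rightarrow> 'b::euclidean_space"
  assumes "f differentiable at x" "inj (frechet_derivative f (at x))"
  obtains d c where "0 < d" "0 < c" "\<And>y. norm (y - x) < d \<Longrightarrow> c * norm (y - x) \<le> norm (f y - f x)"
proof -
  let ?f' = "frechet_derivative f (at x)"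
  have f': "(f has_derivative ?f') (at x)"
    using assms(1) by (simp add: frechet_derivative_works)
  obtain C where C: "C > 0" "\<And>h. C * norm h \<le> norm (?f' h)"
    using linear_inj_bounded_below_pos[OF has_derivative_linear[OF f'] assms(2)] by blast
  obtain d where d: "0 < d"
      "\<And>y. norm (y - x) < d \<Longrightarrow> norm (f y - f x - ?f' (y - x)) \<le> (C/2) * norm (y - x)"
    using f' C(1) unfolding has_derivative_at_alt by (meson half_gt_zero)
  have "(C/2) * norm (y - x) \<le> norm (f y - f x)" if "norm (y - x) < d" for y
  proof -
    have "norm (?f' (y - x)) \<le> norm (f y - f x) + norm (f y - f x - ?f' (y - x))"
      by (metis norm_triangle_sub norm_minus_commute)
    then show ?thesis
      using C(2)[of "y - x"] d(2)[OF that] by (simp add: algebra_simps)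
  qed
  then show thesis using that[of d "C/2"] d(1) C(1) by simp
qed

text \<open>The map \<open>X \<mapsto> (\<kappa> (Q X), R X)\<close> is pointwise Lipschitz where \<open>Q X\<close> lies in the chart, so it
  sends the relevant part of \<open>Z\<close> to a negligible set, which contains \<open>V \<times> B\<close>.\<close>

lemma negligible_chart_preimage:
  fixes \<phi> :: "'p::euclidean_space \<Rightarrow> 'm::euclidean_space"
    and Q :: "'x::euclidean_space \<Rightarrow> 'm" and R :: "'x \<Rightarrow> 'r::euclidean_space"
  assumes dim: "DIM('x) \<le> DIM('p \<times> 'r)"
    and hom: "homeomorphism U (\<phi> ` U) \<phi> \<kappa>"
    and imm: "\<And>u. u \<in> U \<Longrightarrow> \<phi> differentiable at u"
      "\<And>u. u \<in> U \<Longrightarrow> inj (frechet_derivative \<phi> (at u))"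
    and Z: "negligible Z" and B: "\<not> negligible B" and V: "V \<subseteq> U"
    and fib: "\<And>u r. u \<in> V \<Longrightarrow> r \<in> B \<Longrightarrow>
       \<exists>X\<in>Z. Q X = \<phi> u \<and> R X = r \<and> Q differentiable at X \<and> R differentiable at X"
  shows "negligible V"
proof -
  define Z' where "Z' = {X \<in> Z. Q X \<in> \<phi> ` U \<and> Q differentiable at X \<and> R differentiable at X}"
  define G where "G X = (\<kappa> (Q X), R X)" for X
  have \<kappa>\<phi>: "\<kappa> (\<phi> u) = u" if "u \<in> U" for u
    using hom that by (simp add: homeomorphism_def)
  have \<phi>\<kappa>: "\<phi> (\<kappa> y) = y" "\<kappa> y \<in> U" if "y \<in> \<phi> ` U" for y
    using that \<kappa>\<phi> by auto
  have "negligible (G ` Z')"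
  proof (rule negligible_locally_Lipschitz_image[OF dim])
    show "negligible Z'"
      using Z by (rule negligible_subset) (auto simp: Z'_def)
    fix X assume X: "X \<in> Z'"
    then obtain u where u: "u \<in> U" "Q X = \<phi> u" by (auto simp: Z'_def)
    obtain d1 c where c: "0 < d1" "0 < c"
        "\<And>v. norm (v - u) < d1 \<Longrightarrow> c * norm (v - u) \<le> norm (\<phi> v - \<phi> u)"
      using immersion_pointwise_expanding[OF imm(1) imm(2)] u(1) by metis
    \<comment> \<open>The expanding bound holds only near u; continuity of \<kappa> brings the
      preimages of nearby points of the chart into that range.\<close>
    obtain d2 where d2: "0 < d2"
        "\<And>y. y \<in> \<phi> ` U \<Longrightarrow> dist y (\<phi> u) < d2 \<Longrightarrow> dist (\<kappa> y) (\<kappa> (\<phi> u)) < d1"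
      using hom c(1) u(1) unfolding homeomorphism_def continuous_on_iff by (metis imageI)
    obtain d3 L where L: "0 < d3" "\<And>Y. norm (Y - X) < d3 \<Longrightarrow> norm (Q Y - Q X) \<le> L * norm (Y - X)"
      using differentiable_imp_pointwise_Lipschitz[of Q X] X by (auto simp: Z'_def)
    obtain d4 M where M: "0 < d4" "\<And>Y. norm (Y - X) < d4 \<Longrightarrow> norm (R Y - R X) \<le> M * norm (Y - X)"
      using differentiable_imp_pointwise_Lipschitz[of R X] X by (auto simp: Z'_def)
    obtain d5 where d5: "0 < d5" "\<And>Y. dist Y X < d5 \<Longrightarrow> dist (Q Y) (Q X) < d2"
      using differentiable_imp_continuous_within[of Q X UNIV] X d2(1)
      unfolding continuous_at_eps_delta Z'_def by (metis (mono_tags, lifting) mem_Collect_eq)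
    define e where "e = min d3 (min d4 d5)"
    have "norm (G Y - G X) \<le> (L / c + M) * norm (Y - X)" if Y: "Y \<in> Z' \<inter> ball X e" for Y
    proof -
      have dist: "norm (Y - X) < d3" "norm (Y - X) < d4" "dist Y X < d5"
        using Y by (auto simp: e_def dist_norm norm_minus_commute)
      have QY: "Q Y \<in> \<phi> ` U" using Y by (simp add: Z'_def)
      have "norm (\<kappa> (Q Y) - u) < d1"
        using d2(2)[OF QY] d5(2)[OF dist(3)] u \<kappa>\<phi> by (simp add: dist_norm)
      then have "c * norm (\<kappa> (Q Y) - u) \<le> norm (Q Y - Q X)"
        using c(3)[of "\<kappa> (Q Y)"] \<phi>\<kappa>[OF QY] u by simp
      also have "\<dots> \<le> L * norm (Y - X)" using L dist by simp
      finally have "norm (\<kappa> (Q Y) - u) \<le> L / c * norm (Y - X)"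
        using c(2) by (simp add: field_simps)
      moreover have "norm (G Y - G X) \<le> norm (\<kappa> (Q Y) - u) + norm (R Y - R X)"
        using u \<kappa>\<phi> norm_Pair_le[of "\<kappa> (Q Y) - u" "R Y - R X"] by (simp add: G_def)
      ultimately show ?thesis
        using M(2)[OF dist(2)] by (simp add: algebra_simps)
    qed
    then show "\<exists>T B. open T \<and> X \<in> T \<and> (\<forall>Y\<in>Z' \<inter> T. norm (G Y - G X) \<le> B * norm (Y - X))"
      using L(1) M(1) d5(1) by (intro exI[of _ "ball X e"] exI[of _ "L / c + M"])
        (simp add: e_def)
  qed
  moreover have "V \<times> B \<subseteq> G ` Z'"
  proof clarify
    fix u r assume "u \<in> V" "r \<in> B"
    then obtain X where X: "X \<in> Z" "Q X = \<phi> u" "R X = r" "Q differentiable at X" "R differentiable at X"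
      using fib by blast
    moreover have "u \<in> U" using V \<open>u \<in> V\<close> by blast
    ultimately have "X \<in> Z'" "G X = (u, r)"
      by (auto simp: Z'_def G_def \<kappa>\<phi>)
    then show "(u, r) \<in> G ` Z'" by (metis imageI)
  qed
  ultimately have "negligible (V \<times> B)"
    by (rule negligible_subset)
  then show ?thesis
    using B by (rule negligible_Times_left)
qed

section \<open>Almost all triples are symmetrizable\<close>

text \<open>Spelled out over any commutative ring, so that it applies both to complex entries and to
  polynomials in a line parameter.\<close>

definition det3 :: "(3 \<Rightarrow> 'a::comm_ring_1) \<Rightarrow> (3 \<Rightarrow> 'a) \<Rightarrow> (3 \<Rightarrow> 'a) \<Rightarrow> 'a" where
  "det3 x y z = x 1 * y 2 * z 3 + x 2 * y 3 * z 1 + x 3 * y 1 * z 2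
     - x 1 * y 3 * z 2 - x 2 * y 1 * z 3 - x 3 * y 2 * z 1"

text \<open>The determinant of the solution \<open>A\<close>, given by Cramer's rule, of
  \<open>A\<^sub>1\<^sub>1 p + A\<^sub>1\<^sub>2 q = A\<^sub>2\<^sub>1 r + A\<^sub>2\<^sub>2 s\<close>, which expresses the symmetry of all \<open>A K\<^sub>i\<close>.\<close>

definition cofactor_det ::
    "(3 \<Rightarrow> 'a::comm_ring_1) \<Rightarrow> (3 \<Rightarrow> 'a) \<Rightarrow> (3 \<Rightarrow> 'a) \<Rightarrow> (3 \<Rightarrow> 'a) \<Rightarrow> 'a" where
  "cofactor_det p q r s = det3 q r s * det3 p q r - det3 p r s * det3 p q s"

text \<open>The order of the entries comes from equating the (1,2) entry of \<open>A ** K$i\<close>,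
  which involves the second column of \<open>K$i\<close>, with its (2,1) entry, which involves the
  first.\<close>

definition kraus_cofactor_det :: "qubit_op^3 \<Rightarrow> complex" where
  "kraus_cofactor_det K = cofactor_det
     (\<lambda>i. K$i$1$2) (\<lambda>i. K$i$2$2) (\<lambda>i. K$i$1$1) (\<lambda>i. K$i$2$1)"

text \<open>Expansion of the vanishing 4 by 4 determinant whose rows are the three coordinate rows
  of p, q, r, s with row i repeated.\<close>

lemma det3_Cramer:
  "det3 q r s * p i - det3 p r s * q i = - det3 p q s * r i + det3 p q r * s i"
  using exhaust_3[of i] by (elim disjE) (simp_all add: det3_def algebra_simps)

lemma symmetrizable_if_cofactor_det:
  assumes "kraus_cofactor_det K \<noteq> 0"
  shows "symmetrizable K"
proof -
  define p q r s where "p = (\<lambda>i. K$i$1$2)" and "q = (\<lambda>i. K$i$2$2)"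
    and "r = (\<lambda>i. K$i$1$1)" and "s = (\<lambda>i. K$i$2$1)"
  define A :: qubit_op where
    "A = vector [vector [det3 q r s, - det3 p r s], vector [- det3 p q s, det3 p q r]]"
  have A: "A$1$1 = det3 q r s" "A$1$2 = - det3 p r s" "A$2$1 = - det3 p q s" "A$2$2 = det3 p q r"
    by (simp_all add: A_def)
  have "det A = kraus_cofactor_det K"
    by (simp add: det_2 A kraus_cofactor_det_def cofactor_det_def p_def q_def r_def s_def)
  then have "invertible A"
    using assms by (simp add: invertible_det_nz)
  moreover have "transpose (A ** K$i) = A ** K$i" for i
    using det3_Cramer[of q r s p i]
    by (simp add: vec_eq_iff forall_2 transpose_def matrix_matrix_mult_def sum_2 A)
      (simp add: p_def q_def r_def s_def)
  ultimately show ?thesis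
    unfolding symmetrizable_def by blast
qed

section \<open>The cofactor determinant along lines\<close>

lemma poly_det3: "poly (det3 x y z) t = det3 (\<lambda>i. poly (x i) t) (\<lambda>i. poly (y i) t) (\<lambda>i. poly (z i) t)"
  by (simp add: det3_def)

lemma poly_cofactor_det:
  "poly (cofactor_det p q r s) t = cofactor_det (\<lambda>i. poly (p i) t) (\<lambda>i. poly (q i) t)
     (\<lambda>i. poly (r i) t) (\<lambda>i. poly (s i) t)"
  by (simp add: cofactor_det_def poly_det3)

lemma degree_mult_le_add: "degree p \<le> m \<Longrightarrow> degree q \<le> n \<Longrightarrow> degree (p * q) \<le> m + n"
  by (rule order.trans[OF degree_mult_le add_mono])

lemma degree_det3:
  assumes "\<And>i. degree (x i) \<le> 1" "\<And>i. degree (y i) \<le> 1" "\<And>i. degree (z i) \<le> 1"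
  shows "degree (det3 x y z) \<le> 3"
proof -
  have "degree (x i * y j * z k) \<le> 3" for i j k
    using degree_mult_le_add[OF degree_mult_le_add[OF assms(1) assms(2)] assms(3)]
    by (simp add: numeral_3_eq_3)
  then show ?thesis
    unfolding det3_def by (intro degree_add_le degree_diff_le)
qed

lemma degree_cofactor_det:
  assumes "\<And>i. degree (p i) \<le> 1" "\<And>i. degree (q i) \<le> 1" "\<And>i. degree (r i) \<le> 1"
    "\<And>i. degree (s i) \<le> 1"
  shows "degree (cofactor_det p q r s) \<le> 6"
proof -
  have "degree (det3 q r s * det3 p q r) \<le> 3 + 3" "degree (det3 p r s * det3 p q s) \<le> 3 + 3"
    by (intro degree_mult_le_add degree_det3 assms)+
  then show ?thesis
    unfolding cofactor_det_def by (intro degree_diff_le) simp_all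
qed

lemma det3_scale: "det3 (\<lambda>i. c * x i) (\<lambda>i. c * y i) (\<lambda>i. c * z i) = c ^ 3 * det3 x y z"
  by (simp add: det3_def algebra_simps power3_eq_cube)

lemma cofactor_det_scale:
  "cofactor_det (\<lambda>i. c * p i) (\<lambda>i. c * q i) (\<lambda>i. c * r i) (\<lambda>i. c * s i) = c ^ 6 * cofactor_det p q r s"
proof -
  have "c ^ 6 = c ^ 3 * c ^ 3"
    by (simp flip: power_add)
  then show ?thesis
    by (simp add: cofactor_det_def det3_scale algebra_simps)
qed

definition kraus_line_poly :: "qubit_op^3 \<Rightarrow> qubit_op^3 \<Rightarrow> complex poly" where
  "kraus_line_poly X D = cofactor_det
     (\<lambda>i. [:X$i$1$2, D$i$1$2:]) (\<lambda>i. [:X$i$2$2, D$i$2$2:])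
     (\<lambda>i. [:X$i$1$1, D$i$1$1:]) (\<lambda>i. [:X$i$2$1, D$i$2$1:])"

lemma poly_kraus_line_poly:
  "poly (kraus_line_poly X D) (of_real t) = kraus_cofactor_det (X + t *\<^sub>R D)"
  unfolding kraus_line_poly_def poly_cofactor_det kraus_cofactor_det_def
  by (simp add: scaleR_conv_of_real[where 'a = complex])

lemma degree_kraus_line_poly: "degree (kraus_line_poly X D) \<le> 6"
  unfolding kraus_line_poly_def by (intro degree_cofactor_det) simp_all

lemma kraus_cofactor_det_scaleR: "kraus_cofactor_det (c *\<^sub>R X) = of_real c ^ 6 * kraus_cofactor_det X"
  unfolding kraus_cofactor_det_def
  by (simp add: scaleR_conv_of_real[where 'a = complex] cofactor_det_scale)

text \<open>With the roles of \<open>X\<close> and \<open>D\<close> exchanged, the polynomial is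
  nonzero at 0, so some real t other than 0 is not a root. Homogeneity of degree 6 turns
  \<open>D + t X\<close> into \<open>X + (1/t) D\<close>. Thus one direction \<open>D\<close> works
  for every base point.\<close>

lemma kraus_line_poly_nonzero:
  assumes "kraus_cofactor_det D \<noteq> 0"
  shows "kraus_line_poly X D \<noteq> 0"
proof -
  have "poly (kraus_line_poly D X) 0 \<noteq> 0"
    using assms poly_kraus_line_poly[of D X 0] by simp
  then have "finite {z. poly (kraus_line_poly D X) z = 0}"
    by (intro poly_roots_finite) auto
  then have "finite {t::real. poly (kraus_line_poly D X) (of_real t) = 0}"
    using finite_vimageI[OF _ inj_of_real] by (fastforce simp: vimage_def)
  then have "\<exists>t::real. t \<notin> insert 0 {t. poly (kraus_line_poly D X) (of_real t) = 0}"
    by (intro ex_new_if_finite) (simp_all add: infinite_UNIV_char_0)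
  then obtain t :: real where t: "t \<noteq> 0" "kraus_cofactor_det (D + t *\<^sub>R X) \<noteq> 0"
    by (auto simp: poly_kraus_line_poly)
  have "D + t *\<^sub>R X = t *\<^sub>R (X + (1/t) *\<^sub>R D)"
    using t(1) by (simp add: scaleR_add_right)
  then have "poly (kraus_line_poly X D) (of_real (1/t)) \<noteq> 0"
    using t by (simp add: poly_kraus_line_poly kraus_cofactor_det_scaleR del: of_real_divide)
  then show ?thesis by auto
qed

lemma ex_kraus_cofactor_det_nonzero: "\<exists>D. kraus_cofactor_det D \<noteq> 0"
proof
  \<comment> \<open>These matrices span the symmetric ones, so \<open>A\<close> must be a multiple
    of the identity; Cramer's rule gives minus the identity.\<close>
  define D :: "qubit_op^3" where
    "D = vector [matrix_unit 1 1, matrix_unit 2 2, matrix_unit 1 2 + matrix_unit 2 1]"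
  show "kraus_cofactor_det D \<noteq> 0"
    by (simp add: D_def kraus_cofactor_det_def cofactor_det_def det3_def matrix_unit_def)
qed

lemma continuous_kraus_cofactor_det: "continuous_on UNIV kraus_cofactor_det"
  unfolding kraus_cofactor_det_def[abs_def] cofactor_det_def det3_def
  by (intro continuous_intros)

lemma negligible_not_symmetrizable: "negligible {K. \<not> symmetrizable K}"
proof (rule negligible_subset)
  show "{K. \<not> symmetrizable K} \<subseteq> {K. kraus_cofactor_det K = 0}"
    using symmetrizable_if_cofactor_det by blast
  obtain D where D: "kraus_cofactor_det D \<noteq> 0"
    using ex_kraus_cofactor_det_nonzero by blast
  show "negligible {K. kraus_cofactor_det K = 0}"
  proof (rule negligible_finite_slices)
    have "closed {K. kraus_cofactor_det K = 0}"
      using continuous_kraus_cofactor_det by (intro closed_Collect_eq) auto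
    then show "{K. kraus_cofactor_det K = 0} \<in> sets lebesgue"
      by (intro borel_closed sets_completionI_sets) simp_all
    fix X
    let ?P = "kraus_line_poly X D" and ?T = "{t::real. X + t *\<^sub>R D \<in> {K. kraus_cofactor_det K = 0}}"
    have nz: "?P \<noteq> 0" using D by (rule kraus_line_poly_nonzero)
    \<comment> \<open>Real parameters embed among the complex roots, whose number is at most the
      degree, hence at most 6.\<close>
    have sub: "of_real ` ?T \<subseteq> {z. poly ?P z = 0}"
      by (auto simp: poly_kraus_line_poly)
    have fin: "finite {z. poly ?P z = 0}"
      using nz by (rule poly_roots_finite)
    have inj: "inj_on (of_real :: real \<Rightarrow> complex) ?T"
      by (auto simp: inj_on_def)
    show "finite ?T"
      using finite_subset[OF sub fin] inj by (rule finite_imageD)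
    have "card ?T = card ((of_real :: real \<Rightarrow> complex) ` ?T)"
      using inj by (simp add: card_image)
    also have "\<dots> \<le> card {z. poly ?P z = 0}"
      using fin sub by (rule card_mono)
    also have "\<dots> \<le> degree ?P"
      using nz by (rule card_poly_roots_bound)
    also have "\<dots> \<le> 6" by (rule degree_kraus_line_poly)
    finally show "card ?T \<le> 6" .
  qed
qed

section \<open>Right multiplication and Gram-Schmidt coordinates\<close>

lemma symmetrizable_mult_right:
  assumes T: "invertible T" and sym: "symmetrizable (\<chi> r. K$r ** T)"
  shows "symmetrizable K"
proof -
  obtain A where A: "invertible A" "\<And>r. transpose (A ** (K$r ** T)) = A ** (K$r ** T)"
    using sym unfolding symmetrizable_def by auto
  obtain S where S: "T ** S = mat 1" "S ** T = mat 1"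
    using T unfolding invertible_def by blast
  have ST: "transpose S ** transpose T = mat 1" "transpose T ** transpose S = mat 1"
    using S by (metis matrix_transpose_mul transpose_mat)+
  then have "invertible (transpose S)"
    unfolding invertible_def by blast
  then have "invertible (transpose S ** A)"
    using A(1) by (rule invertible_mult)
  moreover have "transpose (transpose S ** A ** K$r) = transpose S ** A ** K$r" for r
  proof -
    \<comment> \<open>With \<open>S\<close> the inverse of \<open>T\<close>, this is a congruence of
      the symmetric matrix \<open>A ** (K$r ** T)\<close>, and congruence preserves
      symmetry.\<close>
    have eq: "transpose S ** A ** K$r = transpose S ** (A ** (K$r ** T)) ** S"
      by (simp add: S flip: matrix_mul_assoc)
    have "transpose (transpose S ** A ** K$r) =
        transpose S ** transpose (A ** (K$r ** T)) ** S"
      unfolding eq by (simp only: matrix_transpose_mul transpose_transpose matrix_mul_assoc)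
    then show ?thesis
      unfolding eq A(2) .
  qed
  ultimately show ?thesis
    unfolding symmetrizable_def by blast
qed

text \<open>Stacking the three operators gives a 6 by 2 matrix; each of its columns is kept as a 3
  by 2 array. Membership in \<open>kraus_triples\<close> means that the columns are orthonormal for
  \<open>herm\<close>.\<close>

definition col :: "2 \<Rightarrow> qubit_op^3 \<Rightarrow> complex^2^3" where
  "col b X = (\<chi> i a. X$i$a$b)"

definition of_cols :: "complex^2^3 \<Rightarrow> complex^2^3 \<Rightarrow> qubit_op^3" where
  "of_cols x y = (\<chi> i a b. if b = 1 then x$i$a else y$i$a)"

definition herm :: "complex^'n^'m \<Rightarrow> complex^'n^'m \<Rightarrow> complex" where
  "herm x y = (\<Sum>i\<in>UNIV. \<Sum>a\<in>UNIV. cnj (x$i$a) * y$i$a)"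

text \<open>The entries of the triangular factor in the QR decomposition of the stacked matrix,
  whose isometric factor is \<open>gs_isometry\<close>. They amount to 1 + 2 + 1 = 4 real
  parameters, the codimension of \<open>kraus_triples\<close>.\<close>

definition gs_coeffs :: "qubit_op^3 \<Rightarrow> real \<times> complex \<times> real" where
  "gs_coeffs X = (let x = col 1 X; q = x /\<^sub>R norm x; b = herm q (col 2 X) in
     (norm x, b, norm (col 2 X - cscale b q)))"

definition gs_isometry :: "qubit_op^3 \<Rightarrow> qubit_op^3" where
  "gs_isometry X = (let x = col 1 X; q = x /\<^sub>R norm x;
     w = col 2 X - cscale (herm q (col 2 X)) q in of_cols q (w /\<^sub>R norm w))"

definition triangular :: "real \<Rightarrow> complex \<Rightarrow> real \<Rightarrow> qubit_op" where
  "triangular a b c = vector [vector [of_real a, b], vector [0, of_real c]]"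

lemma triangular_nth [simp]:
  "triangular a b c $ 1 $ 1 = of_real a" "triangular a b c $ 1 $ 2 = b"
  "triangular a b c $ 2 $ 1 = 0" "triangular a b c $ 2 $ 2 = of_real c"
  by (simp_all add: triangular_def)

lemma of_cols_col: "of_cols (col 1 X) (col 2 X) = X"
  unfolding vec_eq_iff forall_2 by (simp add: of_cols_def col_def)

lemma col_mult_triangular:
  "col 1 (\<chi> r. K$r ** triangular a b c) = a *\<^sub>R col 1 K"
  "col 2 (\<chi> r. K$r ** triangular a b c) = cscale b (col 1 K) + c *\<^sub>R col 2 K"
  by (simp_all add: vec_eq_iff col_def cscale_def matrix_matrix_mult_def sum_2
      scaleR_conv_of_real[where 'a = complex] mult.commute)

lemma herm_norm: "herm x x = of_real ((norm x)\<^sup>2)"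
proof -
  have "(norm x)\<^sup>2 = (\<Sum>i\<in>UNIV. \<Sum>a\<in>UNIV. (norm (x$i$a))\<^sup>2)"
    by (simp add: norm_vec_def L2_set_def sum_nonneg)
  then show ?thesis
    by (simp add: herm_def complex_norm_square mult.commute del: of_real_power)
qed

lemma herm_cols_isometry:
  assumes "K \<in> kraus_triples"
  shows "herm (col i K) (col j K) = (if i = j then 1 else 0)"
proof -
  have "herm (col i K) (col j K) = (\<Sum>r\<in>UNIV. dagger (K $ r) ** (K $ r)) $ i $ j"
    by (simp add: herm_def col_def dagger_def matrix_matrix_mult_def)
  also have "\<dots> = mat 1 $ i $ j"
    using assms by (simp add: kraus_triples_def)
  finally show ?thesis
    by (simp add: mat_def)
qed

lemma norm_col_isometry: "K \<in> kraus_triples \<Longrightarrow> norm (col i K) = 1"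
proof -
  assume "K \<in> kraus_triples"
  then have "complex_of_real ((norm (col i K))\<^sup>2) = of_real 1"
    using herm_cols_isometry[of K i i] by (simp add: herm_norm)
  then have "(norm (col i K))\<^sup>2 = 1\<^sup>2"
    unfolding of_real_eq_iff by simp
  then show ?thesis
    by (rule power2_eq_imp_eq) simp_all
qed

lemma bounded_bilinear_herm: "bounded_bilinear (herm :: complex^'n^'m \<Rightarrow> _)"
  unfolding bilinear_conv_bounded_bilinear[symmetric] bilinear_def herm_def
  by (auto intro!: linearI simp: algebra_simps sum.distrib scaleR_sum_right)

lemma bounded_bilinear_cscale: "bounded_bilinear (cscale :: _ \<Rightarrow> complex^'n^'m \<Rightarrow> _)"
  unfolding bilinear_conv_bounded_bilinear[symmetric] bilinear_def cscale_def
  by (auto intro!: linearI simp: vec_eq_iff algebra_simps)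

lemma bounded_bilinear_differentiable:
  assumes "bounded_bilinear h" "f differentiable (at x within S)" "g differentiable (at x within S)"
  shows "(\<lambda>x. h (f x) (g x)) differentiable (at x within S)"
  using assms bounded_bilinear.FDERIV unfolding differentiable_def by blast

lemma linear_col: "linear (col b)"
  by (rule linearI) (simp_all add: col_def vec_eq_iff)

lemma linear_of_cols: "linear (\<lambda>z. of_cols (fst z) (snd z))"
  by (rule linearI) (simp_all add: of_cols_def vec_eq_iff)

lemma differentiable_normalize:
  fixes f :: "'a::real_normed_vector \<Rightarrow> 'b::real_inner"
  assumes "f differentiable at x" "f x \<noteq> 0"
  shows "(\<lambda>x. f x /\<^sub>R norm (f x)) differentiable at x" "(\<lambda>x. norm (f x)) differentiable at x"
proof -
  show n: "(\<lambda>x. norm (f x)) differentiable at x"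
    using differentiable_compose[OF differentiable_norm_at[OF assms(2)] assms(1)] .
  show "(\<lambda>x. f x /\<^sub>R norm (f x)) differentiable at x"
    using assms by (intro differentiable_scaleR differentiable_inverse n) simp_all
qed

lemma differentiable_Pair:
  assumes "f differentiable (at x within S)" "g differentiable (at x within S)"
  shows "(\<lambda>x. (f x, g x)) differentiable (at x within S)"
  using assms has_derivative_Pair unfolding differentiable_def by blast

text \<open>The hypotheses keep both vectors that Gram-Schmidt normalizes away from 0, the only
  point where the norm fails to be differentiable.\<close>

lemma gs_differentiable:
  fixes X :: "qubit_op^3"
  assumes "col 1 X \<noteq> 0"
    and "col 2 X \<noteq> cscale (herm (col 1 X /\<^sub>R norm (col 1 X)) (col 2 X)) (col 1 X /\<^sub>R norm (col 1 X))"
  shows "gs_isometry differentiable at X" "gs_coeffs differentiable at X"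
proof -
  define q where "q X = col 1 X /\<^sub>R norm (col 1 X)" for X
  define b where "b X = herm (q X) (col 2 X)" for X
  define w where "w X = col 2 X - cscale (b X) (q X)" for X
  have col: "col i differentiable at X" for i
    by (rule linear_imp_differentiable[OF linear_col])
  have q: "q differentiable at X" and n: "(\<lambda>X. norm (col 1 X)) differentiable at X"
    unfolding q_def using differentiable_normalize[OF col assms(1)] .
  have b: "b differentiable at X"
    unfolding b_def by (rule bounded_bilinear_differentiable[OF bounded_bilinear_herm q col])
  have w: "w differentiable at X"
    unfolding w_def
    by (intro differentiable_diff col bounded_bilinear_differentiable[OF bounded_bilinear_cscale b q])
  have w0: "w X \<noteq> 0"
    using assms(2) by (simp add: w_def b_def q_def)
  note W = differentiable_normalize[OF w w0]
  have "gs_coeffs = (\<lambda>X. (norm (col 1 X), b X, norm (w X)))"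
    by (simp add: fun_eq_iff gs_coeffs_def Let_def b_def q_def w_def)
  then show "gs_coeffs differentiable at X"
    using differentiable_Pair[OF n differentiable_Pair[OF b W(2)]] by simp
  have "gs_isometry = (\<lambda>X. (\<lambda>z. of_cols (fst z) (snd z)) (q X, w X /\<^sub>R norm (w X)))"
    by (simp add: fun_eq_iff gs_isometry_def Let_def b_def q_def w_def)
  moreover have "(\<lambda>X. (\<lambda>z. of_cols (fst z) (snd z)) (q X, w X /\<^sub>R norm (w X))) differentiable at X"
    by (rule differentiable_compose[OF linear_imp_differentiable[OF linear_of_cols]
          differentiable_Pair[OF q W(1)]])
  ultimately show "gs_isometry differentiable at X"
    by simp
qed

text \<open>Uniqueness of the QR decomposition: a positive real diagonal leaves no phase freedom, so
  Gram-Schmidt recovers both factors.\<close>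

lemma gs_mult_triangular:
  fixes a c :: real and b :: complex
  assumes K: "K \<in> kraus_triples" and ac: "0 < a" "0 < c"
  defines "X \<equiv> \<chi> r. K$r ** triangular a b c"
  shows "gs_isometry X = K" "gs_coeffs X = (a, b, c)"
    "gs_isometry differentiable at X" "gs_coeffs differentiable at X"
proof -
  note cols = col_mult_triangular[of K a b c, folded X_def]
  have q: "col 1 X /\<^sub>R norm (col 1 X) = col 1 K" and n: "norm (col 1 X) = a"
    using ac by (simp_all add: cols norm_col_isometry[OF K])
  interpret herm: bounded_bilinear "herm :: complex^2^3 \<Rightarrow> _"
    by (rule bounded_bilinear_herm)
  have "herm (col 1 K) (cscale b (col 1 K)) = b * herm (col 1 K) (col 1 K)"
    by (simp add: herm_def cscale_def sum_distrib_left mult_ac)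
  then have b: "herm (col 1 K) (col 2 X) = b"
    by (simp add: cols herm.add_right herm.scaleR_right herm_cols_isometry[OF K])
  have w: "col 2 X - cscale b (col 1 K) = c *\<^sub>R col 2 K"
    by (simp add: cols)
  have nw: "norm (c *\<^sub>R col 2 K) = c"
    using ac by (simp add: norm_col_isometry[OF K])
  show "gs_isometry X = K"
    using ac unfolding gs_isometry_def Let_def q b w nw by (simp add: of_cols_col)
  show "gs_coeffs X = (a, b, c)"
    unfolding gs_coeffs_def Let_def q b w nw by (simp add: n)
  have 1: "col 1 X \<noteq> 0"
    using n ac by auto
  have "c *\<^sub>R col 2 K \<noteq> 0"
    using nw ac by auto
  then have 2: "col 2 X \<noteq> cscale (herm (col 1 X /\<^sub>R norm (col 1 X)) (col 2 X)) (col 1 X /\<^sub>R norm (col 1 X))"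
    unfolding q b w[symmetric] by simp
  show "gs_isometry differentiable at X" "gs_coeffs differentiable at X"
    using gs_differentiable[OF 1 2] .
qed

section \<open>The exceptional set in the charts, and the theorem\<close>

lemma kraus_null_not_symmetrizable: "kraus_null {K \<in> kraus_triples. \<not> symmetrizable K}"
  unfolding kraus_null_def riemannian_null_def
proof (intro conjI allI impI)
  fix U and \<phi> :: "real^20 \<Rightarrow> qubit_op^3"
  assume \<phi>: "local_parametrization kraus_triples U \<phi>"
  let ?V = "{u \<in> U. \<phi> u \<in> {K \<in> kraus_triples. \<not> symmetrizable K}}"
  let ?B = "{0<..} \<times> UNIV \<times> {0<..} :: (real \<times> complex \<times> real) set"
  obtain \<kappa> where \<kappa>: "homeomorphism U (\<phi> ` U) \<phi> \<kappa>"
    using \<phi> unfolding local_parametrization_def by blast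
  have "negligible ?V"
  proof (rule negligible_chart_preimage[OF _ \<kappa>])
    \<comment> \<open>Both sides equal 24, the right one as 20 + 1 + 2 + 1.\<close>
    show "DIM(qubit_op^3) \<le> DIM((real^20) \<times> real \<times> complex \<times> real)"
      by simp
    show "\<phi> differentiable at u" "inj (frechet_derivative \<phi> (at u))" if "u \<in> U" for u
      using \<phi> that unfolding local_parametrization_def by blast+
    show "negligible {K. \<not> symmetrizable K}"
      by (rule negligible_not_symmetrizable)
    have "open ?B"
      by (intro open_Times) auto
    moreover have "(1, 0, 1) \<in> ?B"
      by simp
    ultimately show "\<not> negligible ?B"
      using open_not_negligible by blast
    show "?V \<subseteq> U" by blast
    fix u r assume u: "u \<in> ?V" and "r \<in> ?B"
    then obtain a b c where r: "r = (a, b, c)" "0 < a" "0 < c"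
      by auto
    let ?T = "triangular a b c"
    let ?X = "\<chi> r. \<phi> u $ r ** ?T"
    have "invertible ?T"
      using r by (simp add: invertible_det_nz det_2)
    \<comment> \<open>By contraposition: if \<open>?X\<close> were symmetrizable, so would be
      \<open>\<phi> u\<close>. Hence the whole triangular orbit of \<open>\<phi> u\<close> lies in
      the null set.\<close>
    then have "?X \<in> {K. \<not> symmetrizable K}"
      using u symmetrizable_mult_right by blast
    then show "\<exists>X\<in>{K. \<not> symmetrizable K}. gs_isometry X = \<phi> u \<and> gs_coeffs X = r \<and>
        gs_isometry differentiable at X \<and> gs_coeffs differentiable at X"
      using u r gs_mult_triangular[of "\<phi> u" a c b] by blast
  qed
  then have "?V \<in> null_sets (lebesgue_on U)"
    using \<phi> by (subst null_sets_restrict_space)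
      (auto simp: local_parametrization_def negligible_iff_null_sets)
  then show "?V \<in> null_sets (coordinate_volume U \<phi>)"
    unfolding coordinate_volume_def by (rule null_sets_density)
qed auto

theorem proposition4:
  "\<exists>N \<subseteq> kraus_triples. kraus_null N \<and>
     (\<forall>K \<in> kraus_triples - N. \<forall>\<Lambda>\<^sub>2 :: qubit_op \<Rightarrow> qubit_op. qubit_channel \<Lambda>\<^sub>2 \<longrightarrow>
        \<not> entanglement_annihilating (tensor_map id (\<Lambda>\<^sub>2 \<circ> kraus_channel K)) \<longrightarrow>
        \<not> entanglement_annihilating (tensor_map (kraus_channel K) \<Lambda>\<^sub>2))"
proof (intro exI[of _ "{K \<in> kraus_triples. \<not> symmetrizable K}"] conjI ballI allI impI)
  show "kraus_null {K \<in> kraus_triples. \<not> symmetrizable K}"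
    by (rule kraus_null_not_symmetrizable)
qed (use symmetrizable_not_EA in auto)

end
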